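(* Let $j, k$ and $n$ be positive integers such that $1 \leq j \leq k$. If $n <j$, then $\mathrm{NC}(P_{n,k}^{(j)})=\emptyset$ (the void complex). If $n \geq j$, then $$\mathrm{NC}(P_{n,k}^{(j)}) \simeq \begin{cases} S^{2q} & \text{if } n=(q+1)(k+1) \text{ for some integer } q\ge 0, \\ S^{2q-1} &\text{if } n=q(k+1)+j \text{ for some integer } q\ge 0,\\ * & \text{otherwise}. \end{cases}$$
   Context: A hypergraph $\mathcal{H}$ on a finite vertex set $V$ is a collection of distinct non-empty subsets of $V$, called edges. $W\subseteq V$ is a cover if it meets every edge, and a noncover otherwise; $\mathrm{NC}(\mathcal{H})$ is the simplicial complex on $V$ whose faces are the noncovers of $\mathcal{H}$ (its maximal faces are complements of edges). The void complex is $\emptyset$ (no faces at all); the empty complex $\{\emptyset\}$ is regarded as the sphere $S^{-1}$. $X\simeq Y$ denotes homotopy equivalence, and $X\simeq *$ means $X$ is contractible. $S^m$ is the $m$-dimensional sphere. Tight path: $P_{n,k}$ is the hypergraph on $\{v_1,\ldots,v_n\}$ with edges $\{v_{i+1},\ldots,v_{i+k}\}$, $0\le i\le n-k$ (no edges if $n<k$). For $1\le j\le k$, $P_{n,k}^{(j)}$ is the hypergraph on $\{v_1,\ldots,v_n\}$ obtained from $P_{n,k}$ by deleting the edge $\{v_{n-k+1},\ldots,v_n\}$ if it exists, and then adding the edge $\{v_{n-j+1},\ldots,v_n\}$ if $n\ge j$. (So $P_{n,k}^{(k)}=P_{n,k}$.) *)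

theory Defs
  imports "HOL-Analysis.Analysis"
begin

section \<open>Hypergraphs and noncover complexes\<close>

record 'a hypergraph =
  verts :: "'a set"
  edges :: "'a set set"

definition is_hypergraph :: "'a hypergraph \<Rightarrow> bool" where
  "is_hypergraph H \<longleftrightarrow> finite (verts H) \<and> (\<forall>e\<in>edges H. e \<noteq> {} \<and> e \<subseteq> verts H)"

definition is_cover :: "'a hypergraph \<Rightarrow> 'a set \<Rightarrow> bool" where
  "is_cover H W \<longleftrightarrow> W \<subseteq> verts H \<and> (\<forall>e\<in>edges H. W \<inter> e \<noteq> {})"

text \<open>A simplicial complex is given by its set of faces, the empty face included. So the void
  complex is \<^term>\<open>{}\<close>, and the empty complex is \<^term>\<open>{{}}\<close>.\<close>

definition NC :: "'a hypergraph \<Rightarrow> 'a set set" where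
  "NC H = {W. W \<subseteq> verts H \<and> \<not> is_cover H W}"

section \<open>Homotopy types of finite simplicial complexes\<close>

text \<open>Points of the realization are barycentric coordinates. The topology of pointwise
  convergence is the usual one for complexes with finitely many vertices, the only ones
  needed here.\<close>

definition geometric_realization :: "'a set set \<Rightarrow> ('a \<Rightarrow> real) topology" where
  "geometric_realization K =
     subtopology (powertop_real UNIV)
       {x. (\<forall>v. 0 \<le> x v) \<and> {v. x v \<noteq> 0} \<in> K \<and> (\<Sum>v | x v \<noteq> 0. x v) = 1}"

text \<open>Negative dimensions are relevant only for the (empty) sphere of dimension -1.\<close>

definition sphere_space :: "int \<Rightarrow> (nat \<Rightarrow> real) topology" where
  "sphere_space m = (if m < 0 then discrete_topology {} else nsphere (nat m))"

text \<open>The void complex and the empty complex both have an empty realization, but only the latter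
  counts as the sphere of dimension -1. Hence the condition \<^prop>\<open>K \<noteq> {}\<close>.\<close>

definition homotopic_to_sphere :: "'a set set \<Rightarrow> int \<Rightarrow> bool" where
  "homotopic_to_sphere K m \<longleftrightarrow>
     K \<noteq> {} \<and> geometric_realization K homotopy_equivalent_space sphere_space m"

text \<open>\<^const>\<open>contractible_space\<close> holds of the empty space, which must be excluded.\<close>

definition contractible_complex :: "'a set set \<Rightarrow> bool" where
  "contractible_complex K \<longleftrightarrow>
     topspace (geometric_realization K) \<noteq> {} \<and> contractible_space (geometric_realization K)"

lemma topspace_geometric_realization_eq_empty:
  assumes "\<And>F. F \<in> K \<Longrightarrow> finite F"
  shows "topspace (geometric_realization K) = {} \<longleftrightarrow> K \<subseteq> {{}}"
proof
  assume L: "topspace (geometric_realization K) = {}"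
  show "K \<subseteq> {{}}"
  proof (rule ccontr)
    assume "\<not> K \<subseteq> {{}}"
    then obtain F where F: "F \<in> K" "F \<noteq> {}" by blast
    define x :: "'a \<Rightarrow> real" where "x = (\<lambda>v. if v \<in> F then 1 / card F else 0)"
    have fin: "finite F" using assms F by blast
    then have c: "card F \<noteq> 0" using F by simp
    then have supp: "{v. x v \<noteq> 0} = F" by (auto simp: x_def)
    moreover have "(\<Sum>v\<in>F. x v) = 1" using c by (simp add: x_def)
    moreover have "\<forall>v. 0 \<le> x v" by (simp add: x_def)
    ultimately have "x \<in> topspace (geometric_realization K)"
      using F by (simp add: geometric_realization_def)
    with L show False by blast
  qed
next
  assume "K \<subseteq> {{}}"
  then have "K = {} \<or> K = {{}}" by blast
  then show "topspace (geometric_realization K) = {}"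
    by (auto simp: geometric_realization_def)
qed

lemma homotopic_to_sphere_minus_one_iff:
  assumes "\<And>F. F \<in> K \<Longrightarrow> finite F"
  shows "homotopic_to_sphere K (-1) \<longleftrightarrow> K = {{}}"
proof -
  have "geometric_realization K homotopy_equivalent_space sphere_space (-1)
        \<longleftrightarrow> topspace (geometric_realization K) = {}"
  proof
    assume "geometric_realization K homotopy_equivalent_space sphere_space (-1)"
    then obtain f where "continuous_map (geometric_realization K) (sphere_space (-1)) f"
      unfolding homotopy_equivalent_space_def by blast
    from continuous_map_image_subset_topspace[OF this]
    show "topspace (geometric_realization K) = {}"
      by (simp add: sphere_space_def)
  next
    assume "topspace (geometric_realization K) = {}"
    then have "geometric_realization K = trivial_topology"
      by (simp add: null_topspace_iff_trivial)
    then show "geometric_realization K homotopy_equivalent_space sphere_space (-1)"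
      by (intro homeomorphic_imp_homotopy_equivalent_space)
         (simp add: sphere_space_def homeomorphic_empty_space_eq)
  qed
  then show ?thesis
    using topspace_geometric_realization_eq_empty[OF assms]
    by (auto simp: homotopic_to_sphere_def)
qed

section \<open>Tight paths\<close>

text \<open>The vertices \<open>v\<^sub>1, \<dots>, v\<^sub>n\<close> are represented by \<open>1, \<dots>, n\<close>.\<close>

definition tight_path :: "nat \<Rightarrow> nat \<Rightarrow> nat hypergraph" where
  "tight_path n k = \<lparr>verts = {1..n}, edges = {{i+1..i+k} | i. i + k \<le> n}\<rparr>"

definition modified_tight_path :: "nat \<Rightarrow> nat \<Rightarrow> nat \<Rightarrow> nat hypergraph" where
  "modified_tight_path n k j =
     \<lparr>verts = {1..n},
      edges = (edges (tight_path n k) - (if k \<le> n then {{n-k+1..n}} else {}))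
              \<union> (if j \<le> n then {{n-j+1..n}} else {})\<rparr>"

lemma is_hypergraph_modified_tight_path:
  assumes "1 \<le> j" "j \<le> k"
  shows "is_hypergraph (modified_tight_path n k j)"
  using assms by (auto simp: is_hypergraph_def modified_tight_path_def tight_path_def)

lemma modified_tight_path_same: "modified_tight_path n k k = tight_path n k"
proof -
  have "{n-k+1..n} \<in> {{i+1..i+k} | i. i + k \<le> n}" if "k \<le> n"
    using that by (auto intro!: exI[of _ "n - k"])
  then show ?thesis
    by (simp add: modified_tight_path_def tight_path_def insert_absorb)
qed

end

theory Submission
  imports Defs
begin

text \<open>If every face that contains \<open>v\<close> stays a face after adding \<open>w\<close>, then deleting \<open>v\<close> does not
  change the homotopy type. In the noncover complex of the modified tight path this removes, in
  increasing order, every vertex whose residue modulo \<open>k + 1\<close> is neither \<open>0\<close> nor \<open>1\<close>: the vertex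
  \<open>w = b + 1\<close>, where \<open>b\<close> is the multiple of \<open>k + 1\<close> just below \<open>v\<close>, dominates \<open>v\<close>, because an edge
  that contains \<open>b + 1\<close> but not \<open>v\<close> starts at or below \<open>b\<close>, and among the surviving vertices the edge
  ending at \<open>b\<close> contains only \<open>b\<close>. On the remaining vertices the minimal traces of the edges are
  empty or singletons. If \<open>n\<close> is congruent to \<open>0\<close> or \<open>j\<close>, every remaining vertex is such a trace, so
  the complex is the boundary of a simplex. Otherwise the largest remaining vertex with residue \<open>1\<close>
  lies in no minimal trace, and the complex is a cone.\<close>

section \<open>Deformations of geometric realizations\<close>

lemma topspace_geometric_realization:
  "topspace (geometric_realization K) =
     {x. (\<forall>v. 0 \<le> x v) \<and> {v. x v \<noteq> 0} \<in> K \<and> (\<Sum>v | x v \<noteq> 0. x v) = 1}"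
  by (simp add: geometric_realization_def)

lemma sum_over_support:
  fixes x :: "'a \<Rightarrow> real"
  assumes "finite F" "{v. x v \<noteq> 0} \<subseteq> F"
  shows "(\<Sum>v | x v \<noteq> 0. x v) = sum x F"
  using assms by (intro sum.mono_neutral_left) auto

lemma continuous_map_realization_coord:
  "continuous_map (geometric_realization K) euclideanreal (\<lambda>x. x v)"
  unfolding geometric_realization_def
  by (intro continuous_map_from_subtopology continuous_map_product_projection) auto

text \<open>The realization is a subspace of a product of lines, so continuity is tested coordinate
  by coordinate.\<close>

lemma continuous_map_into_realization:
  "continuous_map X (geometric_realization K) f \<longleftrightarrow>
    (\<forall>v. continuous_map X euclideanreal (\<lambda>y. f y v)) \<and>
    f \<in> topspace X \<rightarrow> topspace (geometric_realization K)"
  by (auto simp: geometric_realization_def continuous_map_in_subtopology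
      continuous_map_componentwise_UNIV)

text \<open>The supports of \<open>x\<close> and \<open>r x\<close> span a common face, so the
  segment joining the two points stays inside that face.\<close>

lemma straight_line_homotopy:
  assumes fin: "\<And>F. F \<in> K \<Longrightarrow> finite F"
    and down: "\<And>F G. F \<in> K \<Longrightarrow> G \<subseteq> F \<Longrightarrow> G \<in> K"
    and r: "continuous_map (geometric_realization K) (geometric_realization K) r"
    and un: "\<And>x. x \<in> topspace (geometric_realization K) \<Longrightarrow> {v. x v \<noteq> 0} \<union> {v. r x v \<noteq> 0} \<in> K"
  shows "homotopic_with (\<lambda>_. True) (geometric_realization K) (geometric_realization K) id r"
proof -
  let ?R = "geometric_realization K"
  let ?P = "prod_topology (top_of_set {0..1::real}) ?R"
  let ?h = "\<lambda>(t,x) v. (1 - t) * x v + t * r x v"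
  have fst: "continuous_map ?P euclideanreal fst"
    using continuous_map_fst[of "top_of_set {0..1::real}" ?R]
    by (simp add: continuous_map_in_subtopology)
  have snd: "continuous_map ?P euclideanreal (\<lambda>z. snd z v)" for v
    using continuous_map_compose[OF continuous_map_snd continuous_map_realization_coord]
    by (simp add: o_def)
  have rsnd: "continuous_map ?P euclideanreal (\<lambda>z. r (snd z) v)" for v
    using continuous_map_compose[OF continuous_map_compose[OF continuous_map_snd r]
        continuous_map_realization_coord]
    by (simp add: o_def)
  have mem: "?h (t, x) \<in> topspace ?R" if t: "0 \<le> t" "t \<le> 1" and x: "x \<in> topspace ?R" for t x
  proof -
    let ?F = "{v. x v \<noteq> 0} \<union> {v. r x v \<noteq> 0}"
    have rx: "r x \<in> topspace ?R"
      using r x continuous_map_image_subset_topspace by blast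
    have F: "?F \<in> K" "finite ?F" using un[OF x] fin by auto
    have sub: "{v. ?h (t, x) v \<noteq> 0} \<subseteq> ?F" by auto
    have s1: "sum x ?F = 1"
      using x sum_over_support[OF F(2), of x] by (auto simp: topspace_geometric_realization)
    have s2: "sum (r x) ?F = 1"
      using rx sum_over_support[OF F(2), of "r x"] by (auto simp: topspace_geometric_realization)
    have "sum (?h (t, x)) ?F = (1 - t) * sum x ?F + t * sum (r x) ?F"
      by (simp add: sum.distrib sum_distrib_left)
    then have "sum (?h (t, x)) ?F = 1" using s1 s2 by simp
    then show ?thesis
      using sum_over_support[OF F(2) sub] down[OF F(1) sub] t x rx
      by (simp add: topspace_geometric_realization)
  qed
  have "continuous_map ?P ?R ?h"
    unfolding continuous_map_into_realization case_prod_unfold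
    using mem by (auto intro!: continuous_intros fst snd rsnd)
  then show ?thesis
    unfolding homotopic_with_def by (intro exI[of _ ?h]) auto
qed

text \<open>The constant map to the vertex \<open>u\<close> and the identity always have supports in
  a common face, so a straight line homotopy contracts the realization to \<open>u\<close>.\<close>

lemma contractible_cone:
  assumes fin: "\<And>F. F \<in> K \<Longrightarrow> finite F"
    and down: "\<And>F G. F \<in> K \<Longrightarrow> G \<subseteq> F \<Longrightarrow> G \<in> K"
    and "K \<noteq> {}" and apex: "\<And>F. F \<in> K \<Longrightarrow> insert u F \<in> K"
  shows "contractible_complex K"
proof -
  let ?p = "\<lambda>v. if v = u then 1 else 0 :: real"
  have "{u} \<in> K" using assms(3) apex down by blast
  then have p: "?p \<in> topspace (geometric_realization K)"
    by (simp add: topspace_geometric_realization)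
  have "homotopic_with (\<lambda>_. True) (geometric_realization K) (geometric_realization K) id (\<lambda>_. ?p)"
  proof (rule straight_line_homotopy[OF fin down])
    fix x assume "x \<in> topspace (geometric_realization K)"
    then have "insert u {v. x v \<noteq> 0} \<in> K"
      using apex by (simp add: topspace_geometric_realization)
    then show "{v. x v \<noteq> 0} \<union> {v. ?p v \<noteq> 0} \<in> K" by simp
  qed (use p in auto)
  with p show ?thesis
    unfolding contractible_complex_def contractible_space_def by blast
qed

text \<open>The deformation moves the barycentric weight of the dominated vertex \<open>v\<close> to \<open>w\<close>.\<close>

lemma dominated_vertex_deletion:
  assumes fin: "\<And>F. F \<in> K \<Longrightarrow> finite F"
    and down: "\<And>F G. F \<in> K \<Longrightarrow> G \<subseteq> F \<Longrightarrow> G \<in> K"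
    and "v \<noteq> w" and dom: "\<And>F. F \<in> K \<Longrightarrow> v \<in> F \<Longrightarrow> insert w F \<in> K"
  shows "geometric_realization K homotopy_equivalent_space geometric_realization {F \<in> K. v \<notin> F}"
proof -
  let ?D = "{F \<in> K. v \<notin> F}"
  let ?R = "geometric_realization K" and ?RD = "geometric_realization ?D"
  let ?r = "\<lambda>x u. if u = v then 0 else if u = w then x w + x v else x u :: real"
  have supp: "{u. x u \<noteq> 0} \<union> {u. ?r x u \<noteq> 0} \<in> K" and mem: "?r x \<in> topspace ?RD"
    if x: "x \<in> topspace ?R" for x
  proof -
    let ?S = "{u. x u \<noteq> 0}"
    \<comment> \<open>This face contains both supports: \<open>w\<close> gains weight only when
      \<open>v\<close> carries some, and then domination allows adding \<open>w\<close>.\<close>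
    let ?F = "if v \<in> ?S then insert w ?S else ?S"
    have S: "?S \<in> K" and nn: "0 \<le> x u" for u
      using x by (auto simp: topspace_geometric_realization)
    have F: "?F \<in> K" "finite ?F" using S dom[OF S] fin[OF S] by auto
    have sub: "?S \<union> {u. ?r x u \<noteq> 0} \<subseteq> ?F" by auto
    then show "?S \<union> {u. ?r x u \<noteq> 0} \<in> K" using down F(1) by blast
    \<comment> \<open>Including \<open>v\<close> and \<open>w\<close> lets both terms be split off
      the sum, whether or not they lie in a support; together they contribute the same before and
      after the move.\<close>
    have fG: "finite (?F \<union> {v, w})" (is "finite ?G") using F(2) by simp
    have subG: "?S \<subseteq> ?G" "{u. ?r x u \<noteq> 0} \<subseteq> ?G" using sub by auto
    have split: "sum y ?G = y v + y w + sum y (?G - {v} - {w})" for y :: "_ \<Rightarrow> real"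
      using fG \<open>v \<noteq> w\<close> sum.remove[of ?G v y] sum.remove[of "?G - {v}" w y] by auto
    have "sum (?r x) (?G - {v} - {w}) = sum x (?G - {v} - {w})"
      by (rule sum.cong) auto
    then have "sum (?r x) ?G = sum x ?G"
      unfolding split[of "?r x"] split[of x] using \<open>v \<noteq> w\<close> by simp
    also have "\<dots> = 1"
      using x sum_over_support[OF fG subG(1)] by (simp add: topspace_geometric_realization)
    finally have one: "(\<Sum>u | ?r x u \<noteq> 0. ?r x u) = 1"
      using sum_over_support[OF fG subG(2)] by simp
    have "{u. ?r x u \<noteq> 0} \<in> K" using sub down[OF F(1)] by blast
    then show "?r x \<in> topspace ?RD"
      using one nn by (auto simp: topspace_geometric_realization)
  qed
  have subD: "topspace ?RD \<subseteq> topspace ?R"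
    by (auto simp: topspace_geometric_realization)
  have rD: "continuous_map ?R ?RD ?r"
    unfolding continuous_map_into_realization
    using mem by (auto intro!: continuous_map_realization_coord continuous_intros)
  have inc: "continuous_map ?RD ?R id"
    unfolding continuous_map_into_realization id_def
    using subD by (auto intro!: continuous_map_realization_coord)
  have r: "continuous_map ?R ?R ?r"
    using continuous_map_compose[OF rD inc] by simp
  have "homotopic_with (\<lambda>_. True) ?R ?R id ?r"
    using straight_line_homotopy[OF fin down r supp] .
  then have "homotopic_with (\<lambda>_. True) ?R ?R (id \<circ> ?r) id"
    by (simp add: homotopic_with_sym)
  moreover have "homotopic_with (\<lambda>_. True) ?RD ?RD (?r \<circ> id) id"
  proof (rule homotopic_with_equal)
    show "continuous_map ?RD ?RD (?r \<circ> id)"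
      using inc rD by (rule continuous_map_compose)
    fix x assume "x \<in> topspace ?RD"
    \<comment> \<open>No weight sits at \<open>v\<close> in the deletion, so the retraction fixes
      its points.\<close>
    then have "x v = 0" by (auto simp: topspace_geometric_realization)
    then show "(?r \<circ> id) x = id x" by (auto simp: fun_eq_iff)
  qed auto
  ultimately show ?thesis
    unfolding homotopy_equivalent_space_def using rD inc by blast
qed

section \<open>The boundary of a simplex as a sphere\<close>

text \<open>Drop the last barycentric coordinate after subtracting it from all the others, then normalize.
  The inverse shifts the coordinates of a point of the sphere, the zero coordinate with
  index \<open>Suc m\<close> included, so that their minimum becomes 0, and rescales.\<close>

lemma simplex_boundary_homeomorphic_nsphere:
  fixes U :: "'a set"
  assumes "finite U" "card U = m + 2"
  shows "geometric_realization {W. W \<subset> U} homeomorphic_space nsphere m"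
proof -
  obtain p where p: "bij_betw p U {..Suc m}"
    using assms finite_same_card_bij[of U "{..Suc m}"] by auto
  define q where "q = inv_into U p"
  have q: "bij_betw q {..Suc m} U" unfolding q_def by (rule bij_betw_inv_into[OF p])
  have pq: "p (q i) = i" "q i \<in> U" if "i \<le> Suc m" for i
    using that p q bij_betw_inv_into_right[OF p, of i] bij_betwE[OF q] by (auto simp: q_def)
  have qp: "q (p v) = v" "p v \<le> Suc m" if "v \<in> U" for v
    using that bij_betw_inv_into_left[OF p] bij_betwE[OF p] by (auto simp: q_def)
  let ?R = "geometric_realization {W. W \<subset> U}"
  define N where "N = (\<lambda>x::'a \<Rightarrow> real. sqrt (\<Sum>i\<le>m. (x (q i) - x (q (Suc m)))\<^sup>2))"
  define f where "f = (\<lambda>x i. if i \<le> m then (x (q i) - x (q (Suc m))) / N x else 0)"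
  define mn where "mn = (\<lambda>s::nat \<Rightarrow> real. INF i\<in>{..Suc m}. s i)"
  define T where "T = (\<lambda>s. \<Sum>i\<le>Suc m. (s i - mn s))"
  define g where "g = (\<lambda>s v. if v \<in> U then (s (p v) - mn s) / T s else 0)"
  have sumU: "sum x U = (\<Sum>i\<le>Suc m. x (q i))" for x :: "'a \<Rightarrow> real"
    using sum.reindex_bij_betw[OF q, of x] by simp
  have mn_le: "mn s \<le> s i" if "i \<le> Suc m" for s i
    unfolding mn_def using that by (intro cINF_lower) auto
  have mn_attained: "\<exists>i\<le>Suc m. mn s = s i" for s
  proof -
    have "mn s \<in> s ` {..Suc m}"
      unfolding mn_def by (subst cInf_eq_Min) (auto intro!: Min_in)
    then show ?thesis by auto
  qed
  have R: "x \<in> topspace ?R \<longleftrightarrow>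
      (\<forall>v. 0 \<le> x v) \<and> (\<forall>v. v \<notin> U \<longrightarrow> x v = 0) \<and> (\<exists>v\<in>U. x v = 0) \<and> sum x U = 1" for x
  proof -
    have a: "{v. x v \<noteq> 0} \<subset> U \<longleftrightarrow> (\<forall>v. v \<notin> U \<longrightarrow> x v = 0) \<and> (\<exists>v\<in>U. x v = 0)"
      by blast
    have b: "(\<Sum>v | x v \<noteq> 0. x v) = sum x U" if "{v. x v \<noteq> 0} \<subset> U"
      using sum_over_support[OF assms(1), of x] that by blast
    have "{v. x v \<noteq> 0} \<subset> U \<and> (\<Sum>v | x v \<noteq> 0. x v) = 1 \<longleftrightarrow>
        ((\<forall>v. v \<notin> U \<longrightarrow> x v = 0) \<and> (\<exists>v\<in>U. x v = 0)) \<and> sum x U = 1"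
      unfolding a[symmetric] using b by (intro conj_cong) simp_all
    then show ?thesis
      unfolding topspace_geometric_realization mem_Collect_eq by blast
  qed
  have S: "s \<in> topspace (nsphere m) \<longleftrightarrow> (\<forall>i. m < i \<longrightarrow> s i = 0) \<and> (\<Sum>i\<le>m. (s i)\<^sup>2) = 1" for s
    by (auto simp: nsphere Suc_le_eq)
  \<comment> \<open>If \<open>N x\<close> vanished, all coordinates would agree; a boundary point
    has a zero coordinate, so they could not sum to 1.\<close>
  have N: "0 < N x" if x: "x \<in> topspace ?R" for x
  proof (rule ccontr)
    assume "\<not> 0 < N x"
    then have "(\<Sum>i\<le>m. (x (q i) - x (q (Suc m)))\<^sup>2) = 0"
      unfolding N_def using sum_nonneg[of "{..m}" "\<lambda>i. (x (q i) - x (q (Suc m)))\<^sup>2"]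
      by (simp add: not_less)
    then have "\<forall>i\<le>m. x (q i) = x (q (Suc m))"
      by (subst (asm) sum_nonneg_eq_0_iff) auto
    then have eq: "x (q i) = x (q (Suc m))" if "i \<le> Suc m" for i
      using that le_Suc_eq by auto
    obtain v where "v \<in> U" "x v = 0" using x R by blast
    then have "x (q (Suc m)) = 0" using eq[of "p v"] qp by simp
    then have "x (q i) = 0" if "i \<le> Suc m" for i using eq[OF that] by simp
    then have "sum x U = 0" unfolding sumU by (intro sum.neutral) simp
    then show False using x R by simp
  qed
  \<comment> \<open>If \<open>T s\<close> vanished, \<open>s\<close> would be constant up to the
    index \<open>Suc m\<close>, where it is 0; it could not be a unit vector.\<close>
  have T: "0 < T s" if s: "s \<in> topspace (nsphere m)" for s
  proof (rule ccontr)
    assume "\<not> 0 < T s"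
    then have "T s = 0"
      unfolding T_def using mn_le sum_nonneg[of "{..Suc m}" "\<lambda>i. s i - mn s"] by fastforce
    then have eq: "\<forall>i\<le>Suc m. s i = mn s"
      unfolding T_def using mn_le by (subst (asm) sum_nonneg_eq_0_iff) auto
    moreover have "s (Suc m) = 0" using s S by simp
    ultimately have "\<forall>i\<le>m. s i = 0" by auto
    then show False using s S by simp
  qed
  have cN: "continuous_map ?R euclideanreal N"
    unfolding N_def
    by (intro continuous_map_realization_coord continuous_intros
        continuous_map_compose[of _ euclideanreal _ _ sqrt, unfolded o_def]) auto
  have coord: "continuous_map (nsphere m) euclideanreal (\<lambda>s. s i)" for i
    by (rule continuous_map_nsphere_projection)
  have cmn: "continuous_map (nsphere m) euclideanreal mn"
    unfolding mn_def by (intro continuous_map_Inf coord) auto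
  have cT: "continuous_map (nsphere m) euclideanreal T"
    unfolding T_def by (intro continuous_intros coord cmn) auto
  \<comment> \<open>At \<open>Suc m\<close> the default value 0 of \<open>f\<close> agrees with the
    quotient, whose numerator is 0.\<close>
  have fi: "f x i = (x (q i) - x (q (Suc m))) / N x" if "i \<le> Suc m" for x i
    using that by (auto simp: f_def le_Suc_eq)
  have gi: "g s (q i) = (s i - mn s) / T s" if "i \<le> Suc m" for s i
    using that pq by (simp add: g_def)
  have fS: "f x \<in> topspace (nsphere m)" if x: "x \<in> topspace ?R" for x
  proof -
    have "(\<Sum>i\<le>m. (f x i)\<^sup>2) = (\<Sum>i\<le>m. (x (q i) - x (q (Suc m)))\<^sup>2) / (N x)\<^sup>2"
      by (simp add: f_def power_divide sum_divide_distrib)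
    also have "\<dots> = 1"
      using N[OF x] by (simp add: N_def sum_nonneg)
    finally show ?thesis by (simp add: S f_def)
  qed
  have gR: "g s \<in> topspace ?R" if s: "s \<in> topspace (nsphere m)" for s
  proof -
    obtain i where i: "i \<le> Suc m" "mn s = s i" using mn_attained by blast
    have "g s (q i) = 0" using i gi by simp
    then have z: "\<exists>v\<in>U. g s v = 0" using i pq by blast
    have "sum (g s) U = (\<Sum>i\<le>Suc m. (s i - mn s) / T s)"
      unfolding sumU by (intro sum.cong) (auto simp: gi)
    also have "\<dots> = T s / T s" by (simp only: T_def sum_divide_distrib)
    finally have "sum (g s) U = 1" using T[OF s] by simp
    moreover have "\<forall>v. 0 \<le> g s v" using T[OF s] mn_le qp by (simp add: g_def)
    ultimately show ?thesis unfolding R using z by (simp add: g_def)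
  qed
  have gf: "g (f x) = x" if x: "x \<in> topspace ?R" for x
  proof -
    let ?c = "x (q (Suc m))"
    obtain v where "v \<in> U" "x v = 0" using x R by blast
    then have v: "p v \<le> Suc m" "x (q (p v)) = 0" using qp by auto
    \<comment> \<open>The least coordinate of \<open>x\<close> is 0, and the minimum of
      \<open>f x\<close> is the image of that 0 under the increasing affine rule.\<close>
    have "mn (f x) = - ?c / N x"
    proof (rule antisym)
      show "mn (f x) \<le> - ?c / N x" using mn_le[OF v(1), of "f x"] v fi by simp
      obtain i where i: "i \<le> Suc m" "mn (f x) = f x i" using mn_attained by blast
      have "0 \<le> x (q i)" using x R by blast
      then show "- ?c / N x \<le> mn (f x)"
        using i fi N[OF x] by (simp add: diff_divide_distrib)
    qed
    then have d: "f x i - mn (f x) = x (q i) / N x" if "i \<le> Suc m" for i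
      using fi[OF that] by (simp add: diff_divide_distrib)
    have "T (f x) = (\<Sum>i\<le>Suc m. x (q i) / N x)"
      unfolding T_def by (intro sum.cong) (auto simp: d)
    also have "\<dots> = sum x U / N x" unfolding sumU by (simp only: sum_divide_distrib)
    finally have "T (f x) = 1 / N x" using x R by simp
    then have "g (f x) u = x u" for u
      using N[OF x] x R d[of "p u"] qp by (cases "u \<in> U") (auto simp: g_def)
    then show ?thesis by blast
  qed
  have fg: "f (g s) = s" if s: "s \<in> topspace (nsphere m)" for s
  proof -
    have s0: "s (Suc m) = 0" "(\<Sum>i\<le>m. (s i)\<^sup>2) = 1" using s S by auto
    \<comment> \<open>Differences of coordinates forget the shift by \<open>mn s\<close>; since
      \<open>s (Suc m) = 0\<close>, what remains is \<open>s\<close> up to scale.\<close>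
    have d: "g s (q i) - g s (q (Suc m)) = s i / T s" if "i \<le> Suc m" for i
      using gi[OF that] gi[of "Suc m"] s0 by (simp add: diff_divide_distrib)
    have "N (g s) = sqrt (\<Sum>i\<le>m. (s i / T s)\<^sup>2)"
      unfolding N_def by (intro arg_cong[where f = sqrt] sum.cong) (auto simp: d)
    also have "\<dots> = sqrt ((\<Sum>i\<le>m. (s i)\<^sup>2) / (T s)\<^sup>2)"
      by (simp add: power_divide sum_divide_distrib)
    also have "\<dots> = 1 / T s" using s0 T[OF s] by (simp add: real_sqrt_divide)
    finally have "f (g s) i = s i" for i
      using d[of i] T[OF s] s S by (auto simp: f_def)
    then show ?thesis by blast
  qed
  have "continuous_map ?R (nsphere m) f"
  proof -
    have "N x \<noteq> 0" if "x \<in> topspace ?R" for x using N[OF that] by simp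
    then have "continuous_map ?R euclideanreal (\<lambda>x. f x i)" for i
      unfolding f_def
      by (cases "i \<le> m")
        (auto intro!: continuous_intros continuous_map_realization_coord cN)
    then show ?thesis
      unfolding nsphere continuous_map_in_subtopology continuous_map_componentwise_UNIV
      using fS by (auto simp: nsphere)
  qed
  moreover have "continuous_map (nsphere m) ?R g"
  proof -
    have "T s \<noteq> 0" if "s \<in> topspace (nsphere m)" for s using T[OF that] by simp
    then have "continuous_map (nsphere m) euclideanreal (\<lambda>s. g s v)" for v
      unfolding g_def
      by (cases "v \<in> U") (auto intro!: continuous_intros coord cmn cT)
    then show ?thesis
      unfolding continuous_map_into_realization using gR by auto
  qed
  ultimately show ?thesis
    unfolding homeomorphic_space_def homeomorphic_maps_def using gf fg by blast
qed

section \<open>Noncover complexes under vertex deletion\<close>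

text \<open>Edges may leave \<open>V\<close>: vertices can then be deleted with \<open>E\<close>
  fixed, and only the traces of the edges on \<open>V\<close> matter.\<close>

definition noncovers :: "'a set \<Rightarrow> 'a set set \<Rightarrow> 'a set set" where
  "noncovers V E = {W. W \<subseteq> V \<and> (\<exists>e\<in>E. W \<inter> e = {})}"

lemma NC_eq_noncovers: "NC H = noncovers (verts H) (edges H)"
  by (auto simp: NC_def noncovers_def is_cover_def)

lemma noncovers_finite: "finite V \<Longrightarrow> F \<in> noncovers V E \<Longrightarrow> finite F"
  by (auto simp: noncovers_def finite_subset)

lemma noncovers_down: "F \<in> noncovers V E \<Longrightarrow> G \<subseteq> F \<Longrightarrow> G \<in> noncovers V E"
  by (auto simp: noncovers_def)

text \<open>An edge missing \<open>F\<close> also misses \<open>insert w F\<close> unless it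
  contains \<open>w\<close>; in that case \<open>e'\<close> takes its place, as its trace on
  \<open>V\<close> is contained in \<open>e\<close>.\<close>

lemma noncovers_insert:
  assumes "w \<in> V"
    and "\<And>e. e \<in> E \<Longrightarrow> e \<inter> F = {} \<Longrightarrow> w \<in> e \<Longrightarrow> \<exists>e'\<in>E. w \<notin> e' \<and> e' \<inter> V \<subseteq> e"
    and F: "F \<in> noncovers V E"
  shows "insert w F \<in> noncovers V E"
proof -
  obtain e where e: "e \<in> E" "e \<inter> F = {}" and FV: "F \<subseteq> V"
    using F by (auto simp: noncovers_def)
  have "\<exists>e'\<in>E. w \<notin> e' \<and> e' \<inter> V \<subseteq> e"
    using e assms(2) by (cases "w \<in> e") auto
  then show ?thesis
    using e FV assms(1) unfolding noncovers_def by blast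
qed

text \<open>Domination concerns only faces through \<open>v\<close>, and an edge missing such a face
  avoids \<open>v\<close>; hence the restriction to edges with \<open>v \<notin> e\<close>.\<close>

lemma noncovers_delete:
  assumes "finite V" "w \<in> V" "v \<noteq> w"
    and "\<And>e. e \<in> E \<Longrightarrow> v \<notin> e \<Longrightarrow> w \<in> e \<Longrightarrow> \<exists>e'\<in>E. w \<notin> e' \<and> e' \<inter> V \<subseteq> e"
  shows "geometric_realization (noncovers V E) homotopy_equivalent_space
         geometric_realization (noncovers (V - {v}) E)"
proof -
  have "{F \<in> noncovers V E. v \<notin> F} = noncovers (V - {v}) E"
    by (auto simp: noncovers_def)
  moreover have "geometric_realization (noncovers V E) homotopy_equivalent_space
      geometric_realization {F \<in> noncovers V E. v \<notin> F}"
  proof (rule dominated_vertex_deletion[OF noncovers_finite noncovers_down \<open>v \<noteq> w\<close>])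
    fix F assume "F \<in> noncovers V E" "v \<in> F"
    then show "insert w F \<in> noncovers V E"
      using assms by (intro noncovers_insert) auto
  qed (use assms in auto)
  ultimately show ?thesis by simp
qed

lemma noncovers_cone:
  assumes "finite V" "u \<in> V" "E \<noteq> {}"
    and "\<And>e. e \<in> E \<Longrightarrow> u \<in> e \<Longrightarrow> \<exists>e'\<in>E. u \<notin> e' \<and> e' \<inter> V \<subseteq> e"
  shows "contractible_complex (noncovers V E)"
proof (rule contractible_cone)
  show "noncovers V E \<noteq> {}" using assms(3) by (auto simp: noncovers_def)
  show "insert u F \<in> noncovers V E" if "F \<in> noncovers V E" for F
    using assms(2,4) that by (intro noncovers_insert) auto
qed (use assms(1) noncovers_finite noncovers_down in blast)+

text \<open>Nonempty traces keep \<open>V\<close> itself from being a face, while a trace inside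
  \<open>{u}\<close> makes \<open>V - {u}\<close> a face.\<close>

lemma noncovers_simplex_boundary:
  assumes "\<And>e. e \<in> E \<Longrightarrow> e \<inter> V \<noteq> {}"
    and "\<And>u. u \<in> V \<Longrightarrow> \<exists>e\<in>E. e \<inter> V \<subseteq> {u}"
  shows "noncovers V E = {W. W \<subset> V}"
proof (intro set_eqI iffI)
  fix W assume "W \<in> noncovers V E"
  then show "W \<in> {W. W \<subset> V}" using assms(1) by (auto simp: noncovers_def)
next
  fix W assume "W \<in> {W. W \<subset> V}"
  then obtain u where "W \<subseteq> V" "u \<in> V" "u \<notin> W" by blast
  with assms(2)[of u] show "W \<in> noncovers V E" unfolding noncovers_def by blast
qed

section \<open>Edges of the modified path and residues modulo \<open>k + 1\<close>\<close>

lemma edges_modified_tight_path: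
  assumes "1 \<le> j" "j \<le> k" "j \<le> n"
  shows "edges (modified_tight_path n k j) = {{i+1..i+k} | i. i + k < n} \<union> {{n-j+1..n}}"
proof -
  \<comment> \<open>The deleted edge contains \<open>n\<close>, which an edge ending before
    \<open>n\<close> does not.\<close>
  have *: "{i+1..i+k} \<noteq> {n-k+1..n}" if "i + k < n" for i
  proof
    assume "{i+1..i+k} = {n-k+1..n}"
    moreover have "n \<in> {n-k+1..n}" using assms by auto
    ultimately show False using that by auto
  qed
  have "{{i+1..i+k} | i. i + k \<le> n} - (if k \<le> n then {{n-k+1..n}} else {})
      = {{i+1..i+k} | i. i + k < n}"
  proof (intro set_eqI iffI)
    fix e assume e: "e \<in> {{i+1..i+k} | i. i + k \<le> n} - (if k \<le> n then {{n-k+1..n}} else {})"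
    then obtain i where i: "e = {i+1..i+k}" "i + k \<le> n" by auto
    then have "i \<noteq> n - k" using e by auto
    then have "i + k < n" using i by auto
    with i show "e \<in> {{i+1..i+k} | i. i + k < n}" by blast
  next
    fix e assume "e \<in> {{i+1..i+k} | i. i + k < n}"
    then obtain i where i: "e = {i+1..i+k}" "i + k < n" by auto
    then have "e \<noteq> {n-k+1..n}" "i + k \<le> n" using * by auto
    with i show "e \<in> {{i+1..i+k} | i. i + k \<le> n} - (if k \<le> n then {{n-k+1..n}} else {})"
      by auto
  qed
  then show ?thesis
    using assms(3) by (simp add: modified_tight_path_def tight_path_def)
qed

text \<open>These are the vertices that survive the collapse. For \<open>k = 1\<close> nothing is
  removed.\<close>

definition core :: "nat \<Rightarrow> nat \<Rightarrow> nat set" where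
  "core n k = {u \<in> {1..n}. u mod (k + 1) \<le> 1}"

lemma residue_above_multiple:
  fixes a k t :: nat
  assumes "t \<le> k"
  shows "(a * (k + 1) + t) mod (k + 1) = t"
  using assms by (metis mod_mult_self3 mod_less less_add_one le_less_trans)

text \<open>The \<open>k\<close> numbers ending at a multiple of \<open>k + 1\<close> have residues
  2, ..., \<open>k\<close>, 0 in this order.\<close>

lemma residue_below_multiple:
  fixes a k u :: nat
  assumes "u \<le> a * (k + 1)" "a * (k + 1) < u + k" "u mod (k + 1) \<le> 1"
  shows "u = a * (k + 1)"
proof (rule ccontr)
  assume ne: "u \<noteq> a * (k + 1)"
  with assms obtain a' where a: "a = Suc a'" by (cases a) auto
  define t where "t = u - a' * (k + 1)"
  have "u = a' * (k + 1) + t" "2 \<le> t" "t \<le> k"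
    using assms ne a by (auto simp: t_def)
  with residue_above_multiple[of t k a'] assms(3) show False by simp
qed

text \<open>Each complete block of \<open>k + 1\<close> vertices contributes its first and its last
  vertex (\<open>?B\<close> and \<open>?A\<close>); an incomplete final block contributes only its
  first.\<close>

lemma card_core:
  assumes "1 \<le> k" "s \<le> k"
  shows "card (core (q * (k + 1) + s) k) = 2 * q + (if s = 0 then 0 else 1)"
proof -
  let ?n = "q * (k + 1) + s" and ?q = "q + (if s = 0 then 0 else 1)"
  let ?A = "(\<lambda>i. (i + 1) * (k + 1)) ` {..<q}" and ?B = "(\<lambda>i. i * (k + 1) + 1) ` {..<?q}"
  have div: "?n div (k + 1) = q"
    using assms by (metis div_mult_self3 div_less le_less_trans less_add_one add.right_neutral add_is_0 one_neq_zero)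
  have "core ?n k = ?A \<union> ?B"
  proof (intro set_eqI iffI)
    fix u assume "u \<in> core ?n k"
    then have u: "1 \<le> u" "u \<le> ?n" "u mod (k + 1) \<le> 1" by (auto simp: core_def)
    define c where "c = u div (k + 1)"
    have c: "u = c * (k + 1) + u mod (k + 1)" unfolding c_def by (simp only: div_mult_mod_eq)
    have cq: "c \<le> q" using div_le_mono[OF u(2), of "k + 1"] div by (simp add: c_def)
    consider "u mod (k + 1) = 0" | "u mod (k + 1) = 1" using u(3) by linarith
    then show "u \<in> ?A \<union> ?B"
    proof cases
      case 1
      then obtain c' where "c = Suc c'" using c u by (cases c) auto
      then show ?thesis using 1 c cq by (intro UnI1 image_eqI[of _ _ c']) auto
    next
      case 2
      \<comment> \<open>For \<open>c = q\<close> the vertex lies in the incomplete block, so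
        \<open>s\<close> is positive.\<close>
      have "c < ?q" using c 2 u(2) cq by (cases "c = q") auto
      then show ?thesis using 2 c by (intro UnI2 image_eqI[of _ _ c]) auto
    qed
  next
    fix u assume "u \<in> ?A \<union> ?B"
    then show "u \<in> core ?n k"
    proof
      assume "u \<in> ?A"
      then obtain i where i: "u = (i + 1) * (k + 1)" "i + 1 \<le> q" by auto
      have "u \<le> q * (k + 1)" unfolding i(1) using i(2) by (rule mult_le_mono1)
      moreover have "u mod (k + 1) = 0" unfolding i(1) by (rule mod_mult_self2_is_0)
      ultimately show ?thesis using i(1) by (auto simp: core_def)
    next
      assume "u \<in> ?B"
      then obtain i where i: "u = i * (k + 1) + 1" "i < ?q" by auto
      have "u \<le> ?n"
      proof (cases "i < q")
        case True
        then have "(i + 1) * (k + 1) \<le> q * (k + 1)" by (intro mult_le_mono1) simp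
        then show ?thesis using i(1) by simp
      next
        case False
        then have "i = q" "s \<noteq> 0" using i(2) by (auto split: if_splits)
        then show ?thesis using i(1) by simp
      qed
      then show ?thesis
        using i(1) residue_above_multiple[of 1 k i] assms(1) by (auto simp: core_def)
    qed
  qed
  moreover have "?A \<inter> ?B = {}"
  proof -
    have "(i + 1) * (k + 1) \<noteq> i' * (k + 1) + 1" for i i'
      using residue_above_multiple[of 1 k i'] residue_above_multiple[of 0 k "i + 1"] assms(1)
      by (metis add.right_neutral le0 one_neq_zero)
    then show ?thesis by blast
  qed
  moreover have "card ?A = q" "card ?B = ?q"
    by (subst card_image;
        simp only: inj_on_def mult_cancel2 add_right_cancel card_lessThan; simp)+
  ultimately show ?thesis by (simp add: card_Un_disjoint)
qed

section \<open>The collapse to the core and the resulting complexes\<close>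

locale tight_path_edges =
  fixes j k n :: nat and E :: "nat set set"
  assumes jk: "1 \<le> j" "j \<le> k" "j \<le> n"
    and E_eq: "E = {{i+1..i+k} | i. i + k < n} \<union> {{n-j+1..n}}"
begin

lemma E_cases:
  assumes "e \<in> E"
  obtains i where "e = {i+1..i+k}" "i + k < n" | "e = {n-j+1..n}"
  using assms E_eq by blast

lemma last_edge: "{n-j+1..n} \<in> E"
  using E_eq by blast

text \<open>These edges have a single surviving vertex, their last one, and serve as replacement
  edges. The bound is strict because the length \<open>k\<close> edge ending at \<open>n\<close> was
  deleted.\<close>

lemma edge_below_multiple:
  assumes "0 < a" "a * (k + 1) < n"
  shows "{a * (k + 1) - k + 1..a * (k + 1)} \<in> E"
proof -
  have "k \<le> a * (k + 1)" using assms(1) by (cases a) auto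
  then have "{a * (k + 1) - k + 1..a * (k + 1)} = {a * (k + 1) - k + 1..a * (k + 1) - k + k}"
    "a * (k + 1) - k + k < n" using assms(2) by auto
  then show ?thesis unfolding E_eq by blast
qed

text \<open>Induction on the position up to which vertices have been thinned out. Increasing order
  matters: the domination of \<open>v\<close> relies on the earlier deletions.\<close>

lemma collapse_to_core:
  "geometric_realization (noncovers {1..n} E) homotopy_equivalent_space
   geometric_realization (noncovers (core n k) E)"
proof -
  define V where "V = (\<lambda>m. {u \<in> {1..n}. u \<le> m \<longrightarrow> u mod (k + 1) \<le> 1})"
  have "geometric_realization (noncovers {1..n} E) homotopy_equivalent_space
        geometric_realization (noncovers (V m) E)" for m
  proof (induction m)
    case 0
    have "V 0 = {1..n}" by (auto simp: V_def)
    then show ?case by (simp add: homotopy_equivalent_space_refl)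
  next
    case (Suc m)
    show ?case
    proof (cases "Suc m \<le> n \<and> \<not> Suc m mod (k + 1) \<le> 1")
      case False
      then have "V (Suc m) = V m" by (auto simp: V_def le_Suc_eq)
      then show ?thesis using Suc by simp
    next
      case True
      define v where "v = Suc m"
      define a where "a = v div (k + 1)"
      define b where "b = a * (k + 1)"
      define r where "r = v mod (k + 1)"
      have v: "v = b + r" "2 \<le> r" "r \<le> k" "v \<le> n"
        using True mod_less_divisor[of "k + 1" v] div_mult_mod_eq[of v "k + 1"]
        unfolding r_def b_def a_def v_def[symmetric] by linarith+
      have "V (Suc m) = V m - {v}" using True by (auto simp: V_def le_Suc_eq v_def)
      moreover have "geometric_realization (noncovers (V m) E) homotopy_equivalent_space
          geometric_realization (noncovers (V m - {v}) E)"
      proof (rule noncovers_delete[where w = "b + 1"])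
        show "finite (V m)" by (simp add: V_def)
        have "(b + 1) mod (k + 1) = 1"
          using residue_above_multiple[of 1 k a] v by (simp add: b_def)
        then show "b + 1 \<in> V m" using v by (simp add: V_def)
        show "v \<noteq> b + 1" using v by simp
        fix e assume e: "e \<in> E" "v \<notin> e" "b + 1 \<in> e"
        from e(1) show "\<exists>e'\<in>E. b + 1 \<notin> e' \<and> e' \<inter> V m \<subseteq> e"
        proof (cases rule: E_cases)
          case (1 i)
          \<comment> \<open>Starting at \<open>b + 1\<close>, the edge would reach
            \<open>b + k\<close> and contain \<open>v\<close>.\<close>
          then have i: "i < b" "b \<le> i + k" using e v by auto
          then have "0 < a" by (auto simp: b_def intro: Nat.gr0I)
          \<comment> \<open>Positions up to \<open>b\<close> lie below \<open>v\<close> and are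
            already thinned out.\<close>
          have "u = b" if "u \<in> {b - k + 1..b} \<inter> V m" for u
            using that v residue_below_multiple[of u a k] by (auto simp: V_def v_def b_def)
          moreover have "b \<in> e" using i 1 by simp
          ultimately have "{b - k + 1..b} \<inter> V m \<subseteq> e" by blast
          moreover have "{b - k + 1..b} \<in> E"
            using edge_below_multiple[OF \<open>0 < a\<close>] v by (simp add: b_def)
          ultimately show ?thesis by (intro bexI[of _ "{b - k + 1..b}"]) auto
        next
          case 2
          \<comment> \<open>The last edge runs up to \<open>n\<close>, so with \<open>b + 1\<close>
            it would contain \<open>v\<close> as well.\<close>
          then show ?thesis using e v by auto
        qed
      qed
      ultimately show ?thesis
        using homotopy_eqv_trans[OF Suc] by simp
    qed
  qed
  moreover have "V n = core n k" by (auto simp: V_def core_def)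
  ultimately show ?thesis by metis
qed

text \<open>A core vertex of residue 0 is the trace of the edge ending there, one of residue 1 that
  of the edge starting there. Such an edge can be absent only near \<open>n\<close>;
  \<open>zero\<close> and \<open>one\<close> say that the vertex affected is then \<open>l\<close>,
  the trace of the last edge.\<close>

lemma core_simplex_boundary:
  assumes last: "{n-j+1..n} \<inter> core n k = {l}"
    and zero: "l = n \<or> \<not> (k + 1) dvd n"
    and one: "\<And>c. c * (k + 1) + 1 \<le> n \<Longrightarrow> n < (c + 1) * (k + 1) \<Longrightarrow> c * (k + 1) + 1 = l"
  shows "noncovers (core n k) E = {W. W \<subset> core n k}"
proof (rule noncovers_simplex_boundary)
  fix e assume "e \<in> E"
  then show "e \<inter> core n k \<noteq> {}"
  proof (cases rule: E_cases)
    case (1 i)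
    define a where "a = i div (k + 1)"
    define c where "c = i mod (k + 1)"
    have i: "i = a * (k + 1) + c" "c \<le> k"
      using mod_less_divisor[of "k + 1" i] div_mult_mod_eq[of i "k + 1"]
      unfolding a_def c_def by linarith+
    show ?thesis
    \<comment> \<open>The \<open>k\<close> vertices after \<open>i\<close> have every residue except
      \<open>c\<close>, so residue 1 occurs if \<open>c = 0\<close>, and residue 0
      otherwise.\<close>
    proof (cases "c = 0")
      case True
      then have "i + 1 \<in> e \<inter> core n k"
        using 1 i jk residue_above_multiple[of 1 k a] by (auto simp: core_def)
      then show ?thesis by blast
    next
      case False
      then have "(a + 1) * (k + 1) \<in> e"
        using 1 i by auto
      moreover have "(a + 1) * (k + 1) mod (k + 1) = 0" by (rule mod_mult_self2_is_0)
      ultimately have "(a + 1) * (k + 1) \<in> e \<inter> core n k"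
        using 1 by (auto simp: core_def)
      then show ?thesis by blast
    qed
  next
    case 2
    then show ?thesis using last by blast
  qed
next
  fix u assume u: "u \<in> core n k"
  define c where "c = u div (k + 1)"
  have c: "u = c * (k + 1) + u mod (k + 1)" unfolding c_def by (simp only: div_mult_mod_eq)
  have u1: "1 \<le> u" "u \<le> n" "u mod (k + 1) \<le> 1" using u by (auto simp: core_def)
  show "\<exists>e\<in>E. e \<inter> core n k \<subseteq> {u}"
  proof (cases "u = l")
    case True
    then show ?thesis using last last_edge by blast
  next
    case False
    consider "u mod (k + 1) = 0" | "u mod (k + 1) = 1" using u1(3) by linarith
    then show ?thesis
    proof cases
      case 1
      then have uc: "u = c * (k + 1)" using c by simp
      have "u \<noteq> n" using zero False 1 by (auto simp: dvd_eq_mod_eq_0)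
      then have "{u - k + 1..u} \<in> E"
        using edge_below_multiple[of c] uc u1 by (cases c) auto
      moreover have "x = u" if "x \<in> {u - k + 1..u} \<inter> core n k" for x
        using that uc residue_below_multiple[of x c k] by (auto simp: core_def)
      ultimately show ?thesis by blast
    next
      case 2
      then have uc: "u = c * (k + 1) + 1" using c by simp
      \<comment> \<open>As \<open>u\<close> is not \<open>l\<close>, its block is complete, so the
        edge starting at \<open>u\<close> ends before \<open>n\<close>.\<close>
      have "(c + 1) * (k + 1) \<le> n" using one[of c] uc u1 False by linarith
      then have "{u..u + k - 1} \<in> E"
        unfolding E_eq using uc by (intro UnI1 CollectI exI[of _ "c * (k + 1)"]) auto
      moreover have "x = u" if x: "x \<in> {u..u + k - 1} \<inter> core n k" for x
      proof -
        define t where "t = x - c * (k + 1)"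
        have "x = c * (k + 1) + t" "1 \<le> t" "t \<le> k"
          using x uc jk by (auto simp: t_def core_def)
        then show ?thesis
          using residue_above_multiple[of t k c] x uc by (auto simp: core_def)
      qed
      ultimately show ?thesis by blast
    qed
  qed
qed

text \<open>The last edge ends at a multiple of \<open>k + 1\<close> and has length at most
  \<open>k\<close>, so its trace is \<open>{n}\<close>.\<close>

lemma core_simplex_boundary_zero:
  assumes n: "n = (q + 1) * (k + 1)"
  shows "noncovers (core n k) E = {W. W \<subset> core n k}"
proof (rule core_simplex_boundary)
  have "n \<in> {n-j+1..n} \<inter> core n k"
    using jk mod_mult_self2_is_0[of "q + 1" "k + 1"] n by (simp add: core_def)
  moreover have "x = n" if "x \<in> {n-j+1..n} \<inter> core n k" for x
    using that jk residue_below_multiple[of x "q + 1" k] n by (auto simp: core_def)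
  ultimately show "{n-j+1..n} \<inter> core n k = {n}" by blast
next
  \<comment> \<open>No block is incomplete here, so the two bounds on \<open>n\<close> contradict
    each other.\<close>
  fix c assume "c * (k + 1) + 1 \<le> n" "n < (c + 1) * (k + 1)"
  then have "c * (k + 1) < (q + 1) * (k + 1)" "(q + 1) * (k + 1) < (c + 1) * (k + 1)"
    using n by linarith+
  then have "c < q + 1" "q + 1 < c + 1" by (simp_all only: mult_less_cancel2)
  then show "c * (k + 1) + 1 = n" by simp
qed simp

text \<open>The last edge is exactly the incomplete block, with residues 1 to \<open>j\<close>; its
  trace is the first vertex of that block.\<close>

lemma core_simplex_boundary_j:
  assumes n: "n = q * (k + 1) + j"
  shows "noncovers (core n k) E = {W. W \<subset> core n k}"
proof (rule core_simplex_boundary)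
  let ?l = "q * (k + 1) + 1"
  have "?l \<in> {n-j+1..n} \<inter> core n k"
    using jk residue_above_multiple[of 1 k q] n by (simp add: core_def)
  moreover have "x = ?l" if x: "x \<in> {n-j+1..n} \<inter> core n k" for x
  proof -
    define t where "t = x - q * (k + 1)"
    have "x = q * (k + 1) + t" "1 \<le> t" "t \<le> k"
      using x n jk by (auto simp: t_def)
    then show ?thesis
      using residue_above_multiple[of t k q] x by (auto simp: core_def)
  qed
  ultimately show "{n-j+1..n} \<inter> core n k = {?l}" by blast
  have "n mod (k + 1) = j" using residue_above_multiple[OF jk(2), of q] n by simp
  then show "?l = n \<or> \<not> (k + 1) dvd n" using jk by (auto simp: dvd_eq_mod_eq_0)
  fix c assume c: "c * (k + 1) + 1 \<le> n" "n < (c + 1) * (k + 1)"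
  then have "c * (k + 1) < (q + 1) * (k + 1)" "q * (k + 1) < (c + 1) * (k + 1)"
    using n jk by auto
  then have "c < q + 1" "q < c + 1" by (simp_all only: mult_less_cancel2)
  then have "c = q" by simp
  then show "c * (k + 1) + 1 = ?l" by simp
qed

text \<open>The apex is \<open>b + 1\<close>, the first vertex of the incomplete block. Every edge
  through it also contains \<open>b\<close>, so the edge ending at \<open>b\<close> can replace
  it.\<close>

lemma core_cone:
  assumes n0: "n mod (k + 1) \<noteq> 0" and nj: "n mod (k + 1) \<noteq> j"
  shows "contractible_complex (noncovers (core n k) E)"
proof -
  define a where "a = n div (k + 1)"
  define b where "b = a * (k + 1)"
  define r where "r = n mod (k + 1)"
  have r: "n = b + r" "0 < r" "r \<le> k" "r \<noteq> j"
    using n0 nj mod_less_divisor[of "k + 1" n] div_mult_mod_eq[of n "k + 1"]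
    unfolding r_def b_def a_def by linarith+
  have *: "\<exists>e'\<in>E. b + 1 \<notin> e' \<and> e' \<inter> core n k \<subseteq> e" if "0 < b" "b \<in> e" for e
  proof -
    have "0 < a" using \<open>0 < b\<close> by (auto simp: b_def)
    then have "{b - k + 1..b} \<in> E"
      using edge_below_multiple[of a] r by (simp add: b_def)
    moreover have "x = b" if "x \<in> {b - k + 1..b} \<inter> core n k" for x
      using that residue_below_multiple[of x a k] by (auto simp: core_def b_def)
    then have "{b - k + 1..b} \<inter> core n k \<subseteq> e" using \<open>b \<in> e\<close> by blast
    ultimately show ?thesis by (intro bexI[of _ "{b - k + 1..b}"]) auto
  qed
  show ?thesis
  proof (rule noncovers_cone)
    show "finite (core n k)" by (simp add: core_def)
    show "b + 1 \<in> core n k"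
      using r residue_above_multiple[of 1 k a] by (simp add: core_def b_def)
    show "E \<noteq> {}" using last_edge by blast
    fix e assume e: "e \<in> E" "b + 1 \<in> e"
    from e(1) show "\<exists>e'\<in>E. b + 1 \<notin> e' \<and> e' \<inter> core n k \<subseteq> e"
    proof (cases rule: E_cases)
      case (1 i)
      \<comment> \<open>Since \<open>n \<le> b + k\<close>, no edge of length \<open>k\<close> that
        ends before \<open>n\<close> starts at \<open>b + 1\<close>.\<close>
      then have "i < b" "b \<le> i + k" using e(2) r by auto
      then show ?thesis using 1 by (intro *) auto
    next
      case 2
      \<comment> \<open>The last edge reaches down to \<open>b + 1\<close>, giving
        \<open>r \<le> j\<close>, and equality is excluded. Then \<open>j \<le> n\<close> forces
        \<open>b\<close> to be positive.\<close>
      then have "r < j" using e(2) r by auto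
      then show ?thesis using 2 r jk by (intro *) auto
    qed
  qed
qed

end

section \<open>Assembling the homotopy types\<close>

lemma homotopic_to_sphere_simplex_boundary:
  assumes "geometric_realization K homotopy_equivalent_space geometric_realization {W. W \<subset> U}"
    and "finite U" "card U = m + 2" "K \<noteq> {}"
  shows "homotopic_to_sphere K (int m)"
proof -
  have "geometric_realization {W. W \<subset> U} homotopy_equivalent_space nsphere m"
    using assms by (intro homeomorphic_imp_homotopy_equivalent_space
        simplex_boundary_homeomorphic_nsphere)
  with assms(1) have "geometric_realization K homotopy_equivalent_space nsphere m"
    by (rule homotopy_eqv_trans)
  then show ?thesis
    using assms(4) by (simp add: homotopic_to_sphere_def sphere_space_def)
qed

text \<open>Nonemptiness has to be carried over separately; the map from the realization of
  \<open>L\<close> to that of \<open>K\<close> does this.\<close>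

lemma contractible_complex_homotopy_equivalent:
  assumes "geometric_realization K homotopy_equivalent_space geometric_realization L"
    and "contractible_complex L"
  shows "contractible_complex K"
proof -
  obtain g where "continuous_map (geometric_realization L) (geometric_realization K) g"
    using assms(1) unfolding homotopy_equivalent_space_def by blast
  then have "topspace (geometric_realization K) \<noteq> {}"
    using assms(2) continuous_map_image_subset_topspace[of _ _ g]
    unfolding contractible_complex_def by blast
  then show ?thesis
    using assms homotopy_equivalent_space_contractibility
    unfolding contractible_complex_def by blast
qed

theorem theorem3p3:
  fixes j k n :: nat
  assumes "0 < n" and "1 \<le> j" and "j \<le> k"
  shows "(n < j \<longrightarrow> NC (modified_tight_path n k j) = {}) \<and>
    (j \<le> n \<longrightarrow>
      (\<forall>q::nat. n = (q + 1) * (k + 1) \<longrightarrow>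
         homotopic_to_sphere (NC (modified_tight_path n k j)) (2 * int q)) \<and>
      (\<forall>q::nat. n = q * (k + 1) + j \<longrightarrow>
         homotopic_to_sphere (NC (modified_tight_path n k j)) (2 * int q - 1)) \<and>
      ((\<nexists>q::nat. n = (q + 1) * (k + 1)) \<and> (\<nexists>q::nat. n = q * (k + 1) + j) \<longrightarrow>
         contractible_complex (NC (modified_tight_path n k j))))"
proof (intro conjI impI allI)
  assume "n < j"
  \<comment> \<open>As \<open>n < j \<le> k\<close>, there are no edges at all, and every vertex set
    is a cover.\<close>
  then show "NC (modified_tight_path n k j) = {}"
    using assms by (auto simp: NC_eq_noncovers noncovers_def modified_tight_path_def tight_path_def)
next
  let ?E = "edges (modified_tight_path n k j)"
  have NC: "NC (modified_tight_path n k j) = noncovers {1..n} ?E"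
    by (simp add: NC_eq_noncovers modified_tight_path_def)
  assume jn: "j \<le> n"
  interpret tight_path_edges j k n ?E
    using assms jn by unfold_locales (simp_all add: edges_modified_tight_path)
  have ne: "NC (modified_tight_path n k j) \<noteq> {}"
    unfolding NC noncovers_def using last_edge by blast
  have fin: "finite (core n k)" by (simp add: core_def)
  note collapse = collapse_to_core[folded NC]
  show "homotopic_to_sphere (NC (modified_tight_path n k j)) (2 * int q)"
    if n: "n = (q + 1) * (k + 1)" for q
  proof -
    have "card (core n k) = 2 * q + 2"
      using card_core[of k 0 "q + 1"] assms n by simp
    then show ?thesis
      using homotopic_to_sphere_simplex_boundary[of _ "core n k" "2 * q"] fin ne
        collapse[unfolded core_simplex_boundary_zero[OF n]] by simp
  qed
  show "homotopic_to_sphere (NC (modified_tight_path n k j)) (2 * int q - 1)"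
    if n: "n = q * (k + 1) + j" for q
  proof (cases q)
    case 0
    then have "n = j" using n by simp
    \<comment> \<open>For \<open>q = 0\<close> the last edge is the whole vertex set and no edge of
      length \<open>k\<close> ends before \<open>n\<close>. The empty set is then the only face,
      giving the sphere of dimension -1.\<close>
    have "e = {1..n}" if "e \<in> ?E" for e
      using that
    proof (cases rule: E_cases)
      case (1 i)
      then show ?thesis using \<open>n = j\<close> assms by simp
    qed (use \<open>n = j\<close> in simp)
    then have "NC (modified_tight_path n k j) = {{}}"
      using ne unfolding NC noncovers_def by fast
    then show ?thesis using 0 homotopic_to_sphere_minus_one_iff[of "{{}} :: nat set set"] by simp
  next
    case (Suc p)
    \<comment> \<open>With \<open>q = p + 1\<close> there are \<open>2 * q + 1\<close> core
      vertices, so the boundary has dimension \<open>2 * p + 1 = 2 * q - 1\<close>.\<close>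
    have "card (core n k) = 2 * p + 1 + 2"
      using card_core[OF _ jk(2), of q] assms n Suc by simp
    then show ?thesis
      using homotopic_to_sphere_simplex_boundary[of _ "core n k" "2 * p + 1"] fin ne
        collapse[unfolded core_simplex_boundary_j[OF n]] Suc by (simp add: algebra_simps)
  qed
  assume "(\<nexists>q::nat. n = (q + 1) * (k + 1)) \<and> (\<nexists>q::nat. n = q * (k + 1) + j)"
  then have no: "n \<noteq> (q + 1) * (k + 1)" "n \<noteq> q * (k + 1) + j" for q by blast+
  have dm: "n = n div (k + 1) * (k + 1) + n mod (k + 1)" by (simp only: div_mult_mod_eq)
  have "n mod (k + 1) \<noteq> j" using no(2)[of "n div (k + 1)"] dm by auto
  moreover have "n mod (k + 1) \<noteq> 0"
  proof
    assume "n mod (k + 1) = 0"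
    with dm have "n = n div (k + 1) * (k + 1)" by simp
    \<comment> \<open>The quotient is positive because \<open>n\<close> is, so subtracting 1 yields
      a valid \<open>q\<close>.\<close>
    with no(1)[of "n div (k + 1) - 1"] assms(1) show False
      by (cases "n div (k + 1)") auto
  qed
  ultimately show "contractible_complex (NC (modified_tight_path n k j))"
    using contractible_complex_homotopy_equivalent[OF collapse core_cone] by blast
qed

end
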